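(* Let $N\ge2$ and let $\{X_n^{(N)}\}$ be the truncated Lamperti chain on $\{1,\dots,N\}$ with transition matrix $P_{(N)}(i,j)=F_{(N)}(j)^i-F_{(N)}(j-1)^i$ and invariant probability measure $\mathbf{\pi}_{(N)}$. Suppose the probability measure $\mathbf{\pi}_0$ on $\{1,\dots,N\}$ is such that $\pi_0(i)/\pi_{(N)}(i)$ decreases with $i$ and $\pi_0(N)=0$. Then $$\frac{\mathbf{P}\left(\tau_{\mathbf{\pi}_0,N}>n\right)}{\mathbf{P}\left(\tau_{\mathbf{\pi}_{(N)},N}>n\right)}\ \underset{n\to\infty}{\longrightarrow}\ \frac{\mathbf{\pi}_{0,0}'\,\mathbf{\phi}_{(N-1)}}{\mathbf{\pi}_{(N-1)}'\,\mathbf{\phi}_{(N-1)}}\ \ge\ 1 .$$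
   Context: Truncated Lamperti chain: let $\mathbf{\pi}$ be the invariant probability measure of a positive recurrent Lamperti chain on $\{1,2,\dots\}$, i.e. of a Markov chain with transition matrix $P(i,j)=F(j)^i-F(j-1)^i$, where $F$ is the distribution function of a random variable $\nu$ with $\mathbf{P}(\nu=j)>0$ for all $j\ge1$, and put $\pi_{(N)}(k)=\pi(k)/\sum_{l=1}^N\pi(l)$, $k=1,\dots,N$. Then $F_{(N)}(j)\in[0,1]$ is determined by $\sum_{k=1}^{j}\pi_{(N)}(k)=\sum_{k=1}^N\pi_{(N)}(k)F_{(N)}(j)^k$, $j=1,\dots,N$, $F_{(N)}(0)=0$. For a probability measure $\mathbf{\sigma}$ on $\{1,\dots,N\}$, $\tau_{\mathbf{\sigma},N}$ is the first hitting time of state $N$ by the chain started from $X_0^{(N)}\sim\mathbf{\sigma}$, with the convention that it equals $0$ if $X_0^{(N)}=N$. The $(N-1)$-dimensional vectors $\mathbf{\pi}_{0,0}$ and $\mathbf{\pi}_{(N-1)}$ are the restrictions of $\mathbf{\pi}_0$ and $\mathbf{\pi}_{(N)}$ to $\{1,\dots,N-1\}$ (without renormalization): $\mathbf{\pi}_0'=(\mathbf{\pi}_{0,0}',0)$ and $\mathbf{\pi}_{(N)}'=(\mathbf{\pi}_{(N-1)}',\pi_{(N)}(N))$; a prime denotes transposition. $P_{(N-1)}$ is the substochastic matrix obtained from $P_{(N)}$ by removing its $N$-th row and column, $\rho_N$ its dominant eigenvalue, and $\mathbf{\mu}_{(N-1)}$, $\mathbf{\phi}_{(N-1)}$ are its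 positive left and right eigenvectors, $\mathbf{\mu}_{(N-1)}'P_{(N-1)}=\rho_N\mathbf{\mu}_{(N-1)}'$, $P_{(N-1)}\mathbf{\phi}_{(N-1)}=\rho_N\mathbf{\phi}_{(N-1)}$, normalized by $\sum_{j=1}^{N-1}\mu_{(N-1)}(j)=1$ and $\mathbf{\mu}_{(N-1)}'\mathbf{\phi}_{(N-1)}=1$. "Decreases" is understood in the weak sense (e.g. $\mathbf{\pi}_0=\delta_1$ is allowed). *)

theory Defs
  imports
    "HOL-Probability.Probability"
    "Jordan_Normal_Form.Spectral_Radius"
begin

unbundle no vec_syntax and no inner_syntax

section \<open>Discrete-time Markov chains\<close>

text \<open>The conditioning event fixes the whole past \<open>X\<^sub>0 = x\<^sub>0, \<dots>, X\<^sub>n = x\<^sub>n\<close> and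
  is required to have positive probability.\<close>

definition markov_chain ::
  "'a measure \<Rightarrow> 's set \<Rightarrow> ('s \<Rightarrow> 's \<Rightarrow> real) \<Rightarrow> ('s \<Rightarrow> real) \<Rightarrow> (nat \<Rightarrow> 'a \<Rightarrow> 's) \<Rightarrow> bool" where
  "markov_chain M S P \<sigma> X \<longleftrightarrow>
     prob_space M \<and>
     (\<forall>n. X n \<in> measurable M (count_space S)) \<and>
     (\<forall>i\<in>S. \<P>(\<omega> in M. X 0 \<omega> = i) = \<sigma> i) \<and>
     (\<forall>n x. \<forall>j\<in>S. (\<forall>k\<le>n. x k \<in> S) \<longrightarrow> \<P>(\<omega> in M. \<forall>k\<le>n. X k \<omega> = x k) > 0 \<longrightarrow>
        \<P>(\<omega> in M. X (Suc n) \<omega> = j \<bar> \<forall>k\<le>n. X k \<omega> = x k) = P (x n) j)"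

definition hitting_time :: "(nat \<Rightarrow> 'a \<Rightarrow> 's) \<Rightarrow> 's \<Rightarrow> 'a \<Rightarrow> enat" where
  "hitting_time X s \<omega> = (INF n\<in>{n. X n \<omega> = s}. enat n)"

text \<open>Probability that the chain started at \<open>i\<close> visits \<open>j\<close> at time \<open>n \<ge> 1\<close> and at no
  time in between.\<close>

fun first_passage :: "'s set \<Rightarrow> ('s \<Rightarrow> 's \<Rightarrow> real) \<Rightarrow> 's \<Rightarrow> 's \<Rightarrow> nat \<Rightarrow> real" where
  "first_passage S P i j 0 = 0"
| "first_passage S P i j (Suc 0) = P i j"
| "first_passage S P i j (Suc (Suc n)) =
     (\<Sum>\<^sub>\<infinity>k\<in>S - {j}. P i k * first_passage S P k j (Suc n))"

text \<open>From every state the return time is almost surely finite and has finite mean.\<close>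

definition positive_recurrent :: "'s set \<Rightarrow> ('s \<Rightarrow> 's \<Rightarrow> real) \<Rightarrow> bool" where
  "positive_recurrent S P \<longleftrightarrow>
     (\<forall>i\<in>S. first_passage S P i i sums 1 \<and>
            summable (\<lambda>n. real n * first_passage S P i i n))"

definition invariant_pmf :: "'s set \<Rightarrow> ('s \<Rightarrow> 's \<Rightarrow> real) \<Rightarrow> 's pmf \<Rightarrow> bool" where
  "invariant_pmf S P \<pi> \<longleftrightarrow>
     set_pmf \<pi> \<subseteq> S \<and> (\<forall>j\<in>S. ((\<lambda>i. pmf \<pi> i * P i j) has_sum pmf \<pi> j) S)"

section \<open>Lamperti chains and their truncations\<close>

text \<open>The matrix is meant for states \<open>i, j \<ge> 1\<close>; its row \<open>i\<close> is the law of the maximum of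
  \<open>i\<close> independent random variables with distribution function \<open>F\<close>.\<close>

definition lamperti_matrix :: "(nat \<Rightarrow> real) \<Rightarrow> nat \<Rightarrow> nat \<Rightarrow> real" where
  "lamperti_matrix F i j = F j ^ i - F (j - 1) ^ i"

definition distr_fun :: "nat pmf \<Rightarrow> nat \<Rightarrow> real" where
  "distr_fun \<nu> j = measure_pmf.prob \<nu> {..j}"

definition truncated_pi :: "nat pmf \<Rightarrow> nat \<Rightarrow> nat \<Rightarrow> real" where
  "truncated_pi \<pi> N k = pmf \<pi> k / (\<Sum>l=1..N. pmf \<pi> l)"

definition truncated_F :: "nat pmf \<Rightarrow> nat \<Rightarrow> nat \<Rightarrow> real" where
  "truncated_F \<pi> N j =
     (if j = 0 then 0
      else THE x. x \<in> {0..1} \<and>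
        (\<Sum>k=1..j. truncated_pi \<pi> N k) = (\<Sum>k=1..N. truncated_pi \<pi> N k * x ^ k))"

abbreviation truncated_P :: "nat pmf \<Rightarrow> nat \<Rightarrow> nat \<Rightarrow> nat \<Rightarrow> real" where
  "truncated_P \<pi> N \<equiv> lamperti_matrix (truncated_F \<pi> N)"

section \<open>Restriction to the first \<open>N - 1\<close> states\<close>

text \<open>States are numbered from \<open>1\<close>, entries of \<open>vec\<close> and \<open>mat\<close> from \<open>0\<close>.\<close>

definition restrict_vec :: "nat \<Rightarrow> (nat \<Rightarrow> real) \<Rightarrow> real vec" where
  "restrict_vec N v = vec (N - 1) (\<lambda>i. v (i + 1))"

definition restrict_mat :: "nat \<Rightarrow> (nat \<Rightarrow> nat \<Rightarrow> real) \<Rightarrow> real mat" where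
  "restrict_mat N P = mat (N - 1) (N - 1) (\<lambda>(i, j). P (i + 1) (j + 1))"

definition positive_vec :: "real vec \<Rightarrow> bool" where
  "positive_vec v \<longleftrightarrow> (\<forall>i<dim_vec v. v $ i > 0)"

definition dominant_eigenvalue :: "real mat \<Rightarrow> real \<Rightarrow> bool" where
  "dominant_eigenvalue A \<rho> \<longleftrightarrow>
     eigenvalue A \<rho> \<and>
     (\<forall>z. eigenvalue (map_mat complex_of_real A) z \<longrightarrow> z \<noteq> complex_of_real \<rho> \<longrightarrow> cmod z < \<bar>\<rho>\<bar>)"

end

theory Submission
  imports Defs
begin

text \<open>Up to a factor \<open>\<rho>\<^sup>n\<close>, the probability that the chain started at \<open>i\<close> avoids \<open>N\<close> up to time
  \<open>n\<close> is \<open>\<phi>(i)\<close> times a harmonic-transform average: the matrix \<open>P(i,j) \<phi>(j) / (\<rho> \<phi>(i))\<close> is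
  stochastic with positive entries, hence contracts oscillations, so these averages converge to a
  positive constant, which cancels in the ratio. For the inequality, each row of the truncated
  matrix is the law of a maximum of \<open>i\<close> independent variables, so the chain is stochastically
  monotone and the probability of avoiding \<open>N\<close> up to time \<open>n\<close> decreases in the starting state.
  Chebyshev's sum inequality then gives a ratio of at least \<open>1\<close> already for every \<open>n\<close>.\<close>

section \<open>Survival probabilities\<close>

text \<open>This is the \<open>n\<close>-th power of \<open>P\<close> restricted to
  \<open>T\<close>, applied to the all-ones vector. A deterministic function of the starting state
  separates the probability space from the matrix analysis.\<close>

fun survival :: "'s set \<Rightarrow> ('s \<Rightarrow> 's \<Rightarrow> real) \<Rightarrow> nat \<Rightarrow> 's \<Rightarrow> real" where
  "survival T P 0 i = 1"
| "survival T P (Suc n) i = (\<Sum>j\<in>T. P i j * survival T P n j)"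

lemma survival_pos:
  assumes "finite T" "T \<noteq> {}" "\<And>i j. i \<in> T \<Longrightarrow> j \<in> T \<Longrightarrow> P i j > 0" "i \<in> T"
  shows "survival T P n i > 0"
  using assms(4) by (induction n arbitrary: i) (auto intro!: sum_pos mult_pos_pos assms(1-3))

text \<open>The infimum counts time \<open>0\<close> and is \<open>\<infinity>\<close> over the
  empty set, so a start in \<open>s\<close> gives \<open>0\<close> and a path that never meets
  \<open>s\<close> exceeds every \<open>n\<close>.\<close>

lemma hitting_time_gt_iff: "hitting_time X s \<omega> > enat n \<longleftrightarrow> (\<forall>k\<le>n. X k \<omega> \<noteq> s)"
proof
  assume gt: "hitting_time X s \<omega> > enat n"
  show "\<forall>k\<le>n. X k \<omega> \<noteq> s"
  proof (intro allI impI notI)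
    fix k assume "k \<le> n" "X k \<omega> = s"
    then have "hitting_time X s \<omega> \<le> enat k"
      unfolding hitting_time_def by (intro INF_lower) auto
    also have "\<dots> \<le> enat n" using \<open>k \<le> n\<close> by simp
    finally show False using gt by simp
  qed
next
  assume avoid: "\<forall>k\<le>n. X k \<omega> \<noteq> s"
  have "enat (Suc n) \<le> hitting_time X s \<omega>"
    unfolding hitting_time_def
    by (intro INF_greatest) (metis (mono_tags) avoid enat_ord_simps(1) mem_Collect_eq not_less_eq_eq)
  then show "hitting_time X s \<omega> > enat n"
    by (metis Suc_ile_eq)
qed

section \<open>Path probabilities of a Markov chain\<close>

lemma markov_chain_pred:
  assumes "markov_chain M S P \<sigma> X"
  shows "Measurable.pred M (\<lambda>\<omega>. Q (X k \<omega>))"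
proof -
  have "X k \<in> measurable M (count_space S)" using assms by (simp add: markov_chain_def)
  then show ?thesis by (rule measurable_compose) simp
qed

text \<open>The definition gives transition probabilities only after a past of positive probability.
  In product form this restriction disappears: after a null past both sides vanish.\<close>

lemma markov_chain_path_step:
  assumes mc: "markov_chain M S P \<sigma> X" and x: "\<forall>k\<le>n. x k \<in> S" and j: "j \<in> S"
  shows "\<P>(\<omega> in M. (\<forall>k\<le>n. X k \<omega> = x k) \<and> X (Suc n) \<omega> = j)
       = \<P>(\<omega> in M. \<forall>k\<le>n. X k \<omega> = x k) * P (x n) j"
proof -
  interpret prob_space M using mc by (simp add: markov_chain_def)
  note [measurable] = markov_chain_pred[OF mc]
  show ?thesis
  proof (cases "\<P>(\<omega> in M. \<forall>k\<le>n. X k \<omega> = x k) > 0")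
    case True
    then have "\<P>(\<omega> in M. X (Suc n) \<omega> = j \<bar> \<forall>k\<le>n. X k \<omega> = x k) = P (x n) j"
      using mc x j unfolding markov_chain_def by blast
    with True show ?thesis
      by (simp add: cond_prob_def field_simps conj_commute)
  next
    case False
    then have "\<P>(\<omega> in M. \<forall>k\<le>n. X k \<omega> = x k) = 0"
      by (simp add: zero_less_measure_iff)
    moreover have "\<P>(\<omega> in M. (\<forall>k\<le>n. X k \<omega> = x k) \<and> X (Suc n) \<omega> = j)
        \<le> \<P>(\<omega> in M. \<forall>k\<le>n. X k \<omega> = x k)"
      by (rule finite_measure_mono) auto
    ultimately show ?thesis by (simp add: measure_le_0_iff)
  qed
qed

text \<open>The Markov property is available for complete paths, so the event is cut into the
  finitely many paths in \<open>T\<close> that end at \<open>i\<close>; each contributes the same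
  factor \<open>P i j\<close>.\<close>

lemma markov_chain_survival_step:
  assumes mc: "markov_chain M S P \<sigma> X" and S: "finite S" "T \<subseteq> S" and ij: "i \<in> T" "j \<in> S"
  shows "\<P>(\<omega> in M. (\<forall>k\<le>n. X k \<omega> \<in> T) \<and> X n \<omega> = i \<and> X (Suc n) \<omega> = j)
       = \<P>(\<omega> in M. (\<forall>k\<le>n. X k \<omega> \<in> T) \<and> X n \<omega> = i) * P i j"
proof -
  interpret prob_space M using mc by (simp add: markov_chain_def)
  note [measurable] = markov_chain_pred[OF mc]
  \<comment> \<open>\<open>PiE\<close> fixes the functions outside \<open>{..n}\<close>: the set is
    finite, and distinct members differ at some time up to \<open>n\<close>, which makes their
    events disjoint.\<close>
  define paths where "paths = {x \<in> PiE {..n} (\<lambda>_. T). x n = i}"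
  have fin: "finite paths"
    unfolding paths_def using finite_subset[OF S(2,1)]
    by (intro finite_subset[OF Collect_restrict] finite_PiE) auto
  \<comment> \<open>The decomposition serves twice: with \<open>Q\<close> the next step to
    \<open>j\<close> and with \<open>Q\<close> trivially true.\<close>
  have split: "\<P>(\<omega> in M. (\<forall>k\<le>n. X k \<omega> \<in> T) \<and> X n \<omega> = i \<and> Q \<omega>)
      = (\<Sum>x\<in>paths. \<P>(\<omega> in M. (\<forall>k\<le>n. X k \<omega> = x k) \<and> Q \<omega>))"
    if [measurable]: "Measurable.pred M Q" for Q
  proof -
    have ev: "(\<lambda>x. {\<omega> \<in> space M. (\<forall>k\<le>n. X k \<omega> = x k) \<and> Q \<omega>}) ` paths \<subseteq> events"
      by (intro image_subsetI) measurable
    have disj: "disjoint_family_on (\<lambda>x. {\<omega> \<in> space M. (\<forall>k\<le>n. X k \<omega> = x k) \<and> Q \<omega>}) paths"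
      unfolding disjoint_family_on_def
    proof (intro ballI impI)
      fix x y assume xy: "x \<in> paths" "y \<in> paths" "x \<noteq> y"
      have "\<exists>k\<le>n. x k \<noteq> y k"
        using xy unfolding paths_def by (metis (mono_tags) PiE_ext atMost_iff mem_Collect_eq)
      then show "{\<omega> \<in> space M. (\<forall>k\<le>n. X k \<omega> = x k) \<and> Q \<omega>}
          \<inter> {\<omega> \<in> space M. (\<forall>k\<le>n. X k \<omega> = y k) \<and> Q \<omega>} = {}"
        by auto
    qed
    have "{\<omega> \<in> space M. (\<forall>k\<le>n. X k \<omega> \<in> T) \<and> X n \<omega> = i \<and> Q \<omega>}
        = (\<Union>x\<in>paths. {\<omega> \<in> space M. (\<forall>k\<le>n. X k \<omega> = x k) \<and> Q \<omega>})"
    proof (intro equalityI subsetI)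
      fix \<omega> assume w: "\<omega> \<in> {\<omega> \<in> space M. (\<forall>k\<le>n. X k \<omega> \<in> T) \<and> X n \<omega> = i \<and> Q \<omega>}"
      then have "restrict (\<lambda>k. X k \<omega>) {..n} \<in> paths"
        unfolding paths_def by auto
      then show "\<omega> \<in> (\<Union>x\<in>paths. {\<omega> \<in> space M. (\<forall>k\<le>n. X k \<omega> = x k) \<and> Q \<omega>})"
        using w by (intro UN_I[of "restrict (\<lambda>k. X k \<omega>) {..n}"]) auto
    qed (auto simp: paths_def)
    then show "\<P>(\<omega> in M. (\<forall>k\<le>n. X k \<omega> \<in> T) \<and> X n \<omega> = i \<and> Q \<omega>)
        = (\<Sum>x\<in>paths. \<P>(\<omega> in M. (\<forall>k\<le>n. X k \<omega> = x k) \<and> Q \<omega>))"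
      using finite_measure_finite_Union[OF fin ev disj] by simp
  qed
  have "\<P>(\<omega> in M. (\<forall>k\<le>n. X k \<omega> \<in> T) \<and> X n \<omega> = i \<and> X (Suc n) \<omega> = j)
      = (\<Sum>x\<in>paths. \<P>(\<omega> in M. (\<forall>k\<le>n. X k \<omega> = x k) \<and> X (Suc n) \<omega> = j))"
    by (rule split) simp
  also have "\<dots> = (\<Sum>x\<in>paths. \<P>(\<omega> in M. \<forall>k\<le>n. X k \<omega> = x k) * P i j)"
  proof (rule sum.cong)
    fix x assume "x \<in> paths"
    then have x: "\<forall>k\<le>n. x k \<in> S" "x n = i" using S by (auto simp: paths_def)
    then show "\<P>(\<omega> in M. (\<forall>k\<le>n. X k \<omega> = x k) \<and> X (Suc n) \<omega> = j)
        = \<P>(\<omega> in M. \<forall>k\<le>n. X k \<omega> = x k) * P i j"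
      using markov_chain_path_step[OF mc x(1) ij(2)] x(2) by simp
  qed simp
  also have "\<dots> = \<P>(\<omega> in M. (\<forall>k\<le>n. X k \<omega> \<in> T) \<and> X n \<omega> = i) * P i j"
    using split[of "\<lambda>_. True"] by (simp add: sum_distrib_right)
  finally show ?thesis .
qed

lemma markov_chain_survival:
  assumes mc: "markov_chain M S P \<sigma> X" and S: "finite S" "T \<subseteq> S"
  shows "\<P>(\<omega> in M. \<forall>k\<le>n. X k \<omega> \<in> T) = (\<Sum>i\<in>T. \<sigma> i * survival T P n i)"
proof -
  interpret prob_space M using mc by (simp add: markov_chain_def)
  note [measurable] = markov_chain_pred[OF mc]
  have finT: "finite T" using S finite_subset by blast
  \<comment> \<open>The law at time \<open>n\<close> on the paths that have stayed in
    \<open>T\<close>. It evolves forwards by \<open>P\<close>, while \<open>survival\<close> evolves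
    backwards.\<close>
  define a where "a n i = \<P>(\<omega> in M. (\<forall>k\<le>n. X k \<omega> \<in> T) \<and> X n \<omega> = i)" for n i
  have a0: "a 0 i = \<sigma> i" if "i \<in> T" for i
  proof -
    have "a 0 i = \<P>(\<omega> in M. X 0 \<omega> = i)"
      unfolding a_def using that by (intro arg_cong[where f = prob]) auto
    with that show ?thesis using mc S by (auto simp: markov_chain_def)
  qed
  have a_Suc: "a (Suc n) j = (\<Sum>i\<in>T. a n i * P i j)" if "j \<in> T" for n j
  proof -
    have "(\<forall>k\<le>Suc n. X k \<omega> \<in> T) \<longleftrightarrow> (\<forall>k\<le>n. X k \<omega> \<in> T) \<and> X (Suc n) \<omega> \<in> T" for \<omega>
      unfolding le_Suc_eq by blast
    then have "{\<omega> \<in> space M. (\<forall>k\<le>Suc n. X k \<omega> \<in> T) \<and> X (Suc n) \<omega> = j}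
        = (\<Union>i\<in>T. {\<omega> \<in> space M. (\<forall>k\<le>n. X k \<omega> \<in> T) \<and> X n \<omega> = i \<and> X (Suc n) \<omega> = j})"
      using that by blast
    then have "a (Suc n) j = prob (\<Union>i\<in>T. {\<omega> \<in> space M. (\<forall>k\<le>n. X k \<omega> \<in> T) \<and> X n \<omega> = i \<and> X (Suc n) \<omega> = j})"
      unfolding a_def by simp
    also have "\<dots> = (\<Sum>i\<in>T. \<P>(\<omega> in M. (\<forall>k\<le>n. X k \<omega> \<in> T) \<and> X n \<omega> = i \<and> X (Suc n) \<omega> = j))"
    proof (rule finite_measure_finite_Union[OF finT])
      show "(\<lambda>i. {\<omega> \<in> space M. (\<forall>k\<le>n. X k \<omega> \<in> T) \<and> X n \<omega> = i \<and> X (Suc n) \<omega> = j}) ` T \<subseteq> events"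
        by (intro image_subsetI) measurable
      show "disjoint_family_on
          (\<lambda>i. {\<omega> \<in> space M. (\<forall>k\<le>n. X k \<omega> \<in> T) \<and> X n \<omega> = i \<and> X (Suc n) \<omega> = j}) T"
        unfolding disjoint_family_on_def by blast
    qed
    also have "\<dots> = (\<Sum>i\<in>T. a n i * P i j)"
      unfolding a_def using that S by (intro sum.cong markov_chain_survival_step[OF mc]) auto
    finally show ?thesis .
  qed
  \<comment> \<open>The two recursions are adjoint: a factor \<open>P\<close> moves from the left
    vector to the right one, so the pairing depends on \<open>n + m\<close> only. Each induction
    step trades one unit of \<open>n\<close> for one of \<open>m\<close>; \<open>m = 0\<close> gives
    the total mass of \<open>a n\<close>.\<close>
  have dual: "(\<Sum>i\<in>T. a n i * survival T P m i) = (\<Sum>i\<in>T. \<sigma> i * survival T P (n + m) i)" for n m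
  proof (induction n arbitrary: m)
    case 0
    then show ?case by (simp add: a0)
  next
    case (Suc n)
    have "(\<Sum>j\<in>T. a (Suc n) j * survival T P m j)
        = (\<Sum>j\<in>T. \<Sum>i\<in>T. a n i * P i j * survival T P m j)"
      by (simp add: a_Suc sum_distrib_right)
    also have "\<dots> = (\<Sum>i\<in>T. a n i * survival T P (Suc m) i)"
      by (subst sum.swap) (simp add: sum_distrib_left mult.assoc)
    finally show ?case using Suc.IH[of "Suc m"] by simp
  qed
  have "\<P>(\<omega> in M. \<forall>k\<le>n. X k \<omega> \<in> T) = prob (\<Union>i\<in>T. {\<omega> \<in> space M. (\<forall>k\<le>n. X k \<omega> \<in> T) \<and> X n \<omega> = i})"
    by (intro arg_cong[where f = prob]) auto
  also have "\<dots> = (\<Sum>i\<in>T. a n i)"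
    unfolding a_def
    by (rule finite_measure_finite_Union) (auto simp: finT disjoint_family_on_def)
  finally show ?thesis using dual[of n 0] by simp
qed

lemma markov_chain_hitting_time_gt:
  assumes mc: "markov_chain M S P \<sigma> X" and S: "finite S"
  shows "\<P>(\<omega> in M. hitting_time X s \<omega> > enat n) = (\<Sum>i\<in>S - {s}. \<sigma> i * survival (S - {s}) P n i)"
proof -
  \<comment> \<open>Measurability into \<open>count_space S\<close> includes that the values lie in
    \<open>S\<close>; avoiding \<open>s\<close> is therefore staying in
    \<open>S - {s}\<close>.\<close>
  have "X k \<omega> \<in> S" if "\<omega> \<in> space M" for k \<omega>
  proof -
    have "X k \<in> measurable M (count_space S)" using mc by (simp add: markov_chain_def)
    from measurable_space[OF this that] show ?thesis by simp
  qed
  then have "{\<omega> \<in> space M. hitting_time X s \<omega> > enat n} = {\<omega> \<in> space M. \<forall>k\<le>n. X k \<omega> \<in> S - {s}}"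
    by (auto simp: hitting_time_gt_iff)
  with markov_chain_survival[OF assms, of "S - {s}" n] show ?thesis by auto
qed

section \<open>Powers of positive matrices\<close>

text \<open>Doeblin contraction: each average gives weight at least \<delta> to a maximiser, so the
  minimum rises by at least \<delta> times the oscillation while the maximum does not rise. The
  oscillation shrinks by the factor \<open>1 - \<delta>\<close>.\<close>

lemma stochastic_iterates_tendsto:
  fixes Q :: "'s \<Rightarrow> 's \<Rightarrow> real" and h :: "nat \<Rightarrow> 's \<Rightarrow> real"
  assumes T: "finite T" "T \<noteq> {}"
    and pos: "\<And>i j. i \<in> T \<Longrightarrow> j \<in> T \<Longrightarrow> Q i j > 0"
    and stoch: "\<And>i. i \<in> T \<Longrightarrow> (\<Sum>j\<in>T. Q i j) = 1"
    and h_Suc: "\<And>n i. i \<in> T \<Longrightarrow> h (Suc n) i = (\<Sum>j\<in>T. Q i j * h n j)"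
    and h0: "\<And>i. i \<in> T \<Longrightarrow> h 0 i > 0"
  shows "\<exists>c>0. \<forall>i\<in>T. (\<lambda>n. h n i) \<longlonglongrightarrow> c"
proof -
  define lo hi where "lo n = Min (h n ` T)" and "hi n = Max (h n ` T)" for n
  define \<delta> where "\<delta> = Min ((\<lambda>(i, j). Q i j) ` (T \<times> T))"
  have \<delta>_le: "\<delta> \<le> Q i j" if "i \<in> T" "j \<in> T" for i j
    unfolding \<delta>_def using T that by (intro Min_le) auto
  have \<delta>_pos: "\<delta> > 0"
    unfolding \<delta>_def using T pos by (subst Min_gr_iff) auto
  obtain i0 where i0: "i0 \<in> T" using T by auto
  have Q_nonneg: "Q i j \<ge> 0" if "i \<in> T" "j \<in> T" for i j
    using pos[OF that] by simp
  \<comment> \<open>An entry is at most its row sum, so the contraction factor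
    \<open>1 - \<delta>\<close> is nonnegative.\<close>
  have "\<delta> \<le> Q i0 i0" using \<delta>_le i0 by simp
  also have "\<dots> \<le> (\<Sum>j\<in>T. Q i0 j)"
    using T i0 Q_nonneg by (intro member_le_sum) auto
  finally have \<delta>_le_1: "\<delta> \<le> 1" using stoch i0 by simp
  have lo_le: "lo n \<le> h n i" and le_hi: "h n i \<le> hi n" if "i \<in> T" for n i
    using T that by (auto simp: lo_def hi_def)
  have lower: "lo n + \<delta> * (hi n - lo n) \<le> h (Suc n) i" if i: "i \<in> T" for n i
  proof -
    have "hi n \<in> h n ` T" unfolding hi_def using T by (intro Max_in) auto
    then obtain m where m: "m \<in> T" "hi n = h n m" by auto
    have "\<delta> * (hi n - lo n) \<le> Q i m * (h n m - lo n)"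
      using m \<delta>_le[OF i m(1)] lo_le[OF m(1)] by (auto intro: mult_right_mono)
    \<comment> \<open>After subtraction of \<open>lo n\<close> all terms are nonnegative, so the
      term at the maximiser \<open>m\<close> bounds the sum from below.\<close>
    also have "\<dots> \<le> (\<Sum>j\<in>T. Q i j * (h n j - lo n))"
      using T m lo_le Q_nonneg[OF i] by (intro member_le_sum) auto
    also have "\<dots> = h (Suc n) i - lo n"
      by (simp add: h_Suc[OF i] right_diff_distrib sum_subtractf stoch[OF i] flip: sum_distrib_right)
    finally show ?thesis by simp
  qed
  have upper: "h (Suc n) i \<le> hi n" if i: "i \<in> T" for n i
  proof -
    have "h (Suc n) i \<le> (\<Sum>j\<in>T. Q i j * hi n)"
      unfolding h_Suc[OF i] using Q_nonneg[OF i] le_hi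
      by (intro sum_mono mult_left_mono) auto
    also have "\<dots> = hi n" by (simp add: stoch[OF i] flip: sum_distrib_right)
    finally show ?thesis .
  qed
  have lo_hi: "lo n \<le> hi n" for n using lo_le[OF i0] le_hi[OF i0] by (rule order_trans)
  have lo_Suc: "lo n + \<delta> * (hi n - lo n) \<le> lo (Suc n)" for n
    unfolding lo_def[of "Suc n"] using T lower by (subst Min_ge_iff) auto
  have hi_Suc: "hi (Suc n) \<le> hi n" for n
    unfolding hi_def[of "Suc n"] using T upper by (subst Max_le_iff) auto
  have "incseq lo"
  proof (rule incseq_SucI)
    fix n
    have "0 \<le> \<delta> * (hi n - lo n)" using \<delta>_pos lo_hi[of n] by simp
    with lo_Suc[of n] show "lo n \<le> lo (Suc n)" by linarith
  qed
  have "decseq hi" using hi_Suc by (rule decseq_SucI)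
  have "lo n \<le> hi 0" for n
    using lo_hi[of n] decseqD[OF \<open>decseq hi\<close>, of 0 n] by simp
  then obtain c where c: "lo \<longlonglongrightarrow> c" "\<And>n. lo n \<le> c"
    using incseq_convergent[OF \<open>incseq lo\<close>] by metis
  have osc: "hi n - lo n \<le> (1 - \<delta>) ^ n * (hi 0 - lo 0)" for n
  proof (induction n)
    case (Suc n)
    have "hi (Suc n) - lo (Suc n) \<le> (1 - \<delta>) * (hi n - lo n)"
      using lo_Suc[of n] hi_Suc[of n] by (simp add: algebra_simps)
    also have "\<dots> \<le> (1 - \<delta>) * ((1 - \<delta>) ^ n * (hi 0 - lo 0))"
      using Suc.IH \<delta>_le_1 by (intro mult_left_mono) auto
    finally show ?case by simp
  qed simp
  have "(\<lambda>n. (1 - \<delta>) ^ n * (hi 0 - lo 0)) \<longlonglongrightarrow> 0"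
    using \<delta>_pos \<delta>_le_1 by (intro tendsto_mult_left_zero LIMSEQ_power_zero) auto
  then have "(\<lambda>n. hi n - lo n) \<longlonglongrightarrow> 0"
    by (rule tendsto_sandwich[rotated 3]) (use osc lo_hi in auto)
  from tendsto_add[OF this c(1)] have hi: "hi \<longlonglongrightarrow> c" by simp
  \<comment> \<open>\<open>lo\<close> increases to \<open>c\<close>, so the positive initial minimum
    keeps the limit away from \<open>0\<close>.\<close>
  have "lo 0 > 0" unfolding lo_def using T h0 by (subst Min_gr_iff) auto
  then have "c > 0" using c(2)[of 0] by simp
  moreover have "(\<lambda>n. h n i) \<longlonglongrightarrow> c" if "i \<in> T" for i
    by (rule tendsto_sandwich[OF _ _ c(1) hi]) (use lo_le le_hi that in auto)
  ultimately show ?thesis by auto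
qed

text \<open>Doob transform: conjugation by the positive eigenvector and division by \<rho> make
  \<open>P\<close> stochastic. The contraction then yields one constant \<open>c\<close> for all
  starting states.\<close>

lemma survival_asymptotics:
  fixes P :: "'s \<Rightarrow> 's \<Rightarrow> real"
  assumes T: "finite T" "T \<noteq> {}"
    and pos: "\<And>i j. i \<in> T \<Longrightarrow> j \<in> T \<Longrightarrow> P i j > 0"
    and \<phi>_pos: "\<And>i. i \<in> T \<Longrightarrow> \<phi> i > 0"
    and eig: "\<And>i. i \<in> T \<Longrightarrow> (\<Sum>j\<in>T. P i j * \<phi> j) = \<rho> * \<phi> i"
  shows "\<rho> > 0" "\<exists>c>0. \<forall>i\<in>T. (\<lambda>n. survival T P n i / \<rho> ^ n) \<longlonglongrightarrow> c * \<phi> i"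
proof -
  obtain i0 where i0: "i0 \<in> T" using T by auto
  have "(\<Sum>j\<in>T. P i0 j * \<phi> j) > 0" using T pos[OF i0] \<phi>_pos by (intro sum_pos) auto
  then show \<rho>: "\<rho> > 0" using eig[OF i0] \<phi>_pos[OF i0] by (simp add: zero_less_mult_iff)
  define h where "h n i = survival T P n i / (\<rho> ^ n * \<phi> i)" for n i
  have "\<exists>c>0. \<forall>i\<in>T. (\<lambda>n. h n i) \<longlonglongrightarrow> c"
  proof (rule stochastic_iterates_tendsto[OF T, where Q = "\<lambda>i j. P i j * \<phi> j / (\<rho> * \<phi> i)"])
    show "P i j * \<phi> j / (\<rho> * \<phi> i) > 0" if "i \<in> T" "j \<in> T" for i j
      using that pos \<phi>_pos \<rho> by simp
    show "(\<Sum>j\<in>T. P i j * \<phi> j / (\<rho> * \<phi> i)) = 1" if "i \<in> T" for i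
      using eig[OF that] \<phi>_pos[OF that] \<rho> by (simp flip: sum_divide_distrib)
    show "h (Suc n) i = (\<Sum>j\<in>T. P i j * \<phi> j / (\<rho> * \<phi> i) * h n j)" if "i \<in> T" for n i
    proof -
      \<comment> \<open>The factor \<open>\<phi> j\<close> of the kernel cancels the one in the
        denominator of \<open>h n j\<close>, leaving the recursion of
        \<open>survival\<close>.\<close>
      have "P i j * \<phi> j / (\<rho> * \<phi> i) * h n j = P i j * survival T P n j / (\<rho> ^ Suc n * \<phi> i)"
        if "j \<in> T" for j
        using \<phi>_pos[OF that] by (simp add: h_def field_simps)
      then show ?thesis by (simp add: h_def flip: sum_divide_distrib)
    qed
    show "h 0 i > 0" if "i \<in> T" for i using \<phi>_pos[OF that] by (simp add: h_def)
  qed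
  then obtain c where c: "c > 0" "\<And>i. i \<in> T \<Longrightarrow> (\<lambda>n. h n i) \<longlonglongrightarrow> c" by auto
  have "(\<lambda>n. survival T P n i / \<rho> ^ n) \<longlonglongrightarrow> c * \<phi> i" if "i \<in> T" for i
  proof -
    have "h n i * \<phi> i = survival T P n i / \<rho> ^ n" for n
      using \<phi>_pos[OF that] by (simp add: h_def)
    with tendsto_mult_right[OF c(2)[OF that], of "\<phi> i"] show ?thesis by simp
  qed
  with c(1) show "\<exists>c>0. \<forall>i\<in>T. (\<lambda>n. survival T P n i / \<rho> ^ n) \<longlonglongrightarrow> c * \<phi> i" by auto
qed

section \<open>Stochastic monotonicity\<close>

text \<open>Similarly ordered functions have products of differences
  \<open>(r i - r j) * (g i - g j)\<close> that are never negative; their weighted double sum is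
  twice the covariance.\<close>

lemma weighted_chebyshev_sum:
  fixes p r g :: "'i :: linorder \<Rightarrow> real"
  assumes p: "\<And>i. i \<in> A \<Longrightarrow> p i \<ge> 0" and p1: "(\<Sum>i\<in>A. p i) = 1"
    and r: "antimono_on A r" and g: "antimono_on A g"
  shows "(\<Sum>i\<in>A. p i * r i) * (\<Sum>i\<in>A. p i * g i) \<le> (\<Sum>i\<in>A. p i * r i * g i)"
proof -
  have "0 \<le> (r i - r j) * (g i - g j)" if "i \<in> A" "j \<in> A" for i j
    using that monotone_onD[OF r, of i j] monotone_onD[OF r, of j i]
      monotone_onD[OF g, of i j] monotone_onD[OF g, of j i]
    by (cases "i \<le> j") (auto intro: mult_nonneg_nonneg mult_nonpos_nonpos)
  then have "0 \<le> (\<Sum>i\<in>A. \<Sum>j\<in>A. p i * p j * ((r i - r j) * (g i - g j)))"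
    using p by (intro sum_nonneg mult_nonneg_nonneg[OF mult_nonneg_nonneg]) auto
  also have "\<dots> = (\<Sum>i\<in>A. \<Sum>j\<in>A. (p i * r i * g i) * p j + p i * (p j * r j * g j)
      - (p i * r i) * (p j * g j) - (p i * g i) * (p j * r j))"
    by (intro sum.cong) (auto simp: algebra_simps)
  also have "\<dots> = 2 * ((\<Sum>i\<in>A. p i * r i * g i) - (\<Sum>i\<in>A. p i * r i) * (\<Sum>i\<in>A. p i * g i))"
    by (simp add: sum.distrib sum_subtractf p1 flip: sum_distrib_left sum_distrib_right)
  finally show ?thesis by simp
qed

text \<open>On \<open>[0,1]\<close> a higher power is smaller, so row \<open>i'\<close>
  stochastically dominates row \<open>i\<close>. Summation by parts carries this over to decreasing
  \<open>g\<close>.\<close>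

lemma lamperti_matrix_antimono:
  assumes F0: "F 0 = 0" and FN: "F N = 1" and F: "\<And>j. j \<le> N \<Longrightarrow> F j \<in> {0..1}"
    and g: "antimono_on {1..N} g" and ii': "1 \<le> i" "i \<le> i'"
  shows "(\<Sum>j=1..N. lamperti_matrix F i' j * g j) \<le> (\<Sum>j=1..N. lamperti_matrix F i j * g j)"
proof -
  \<comment> \<open>The difference of the cumulative sums of rows \<open>i\<close> and
    \<open>i'\<close>; it vanishes at both ends \<open>0\<close> and \<open>N\<close>.\<close>
  define D where "D j = F j ^ i - F j ^ i'" for j
  have D_nonneg: "D j \<ge> 0" if "j \<le> N" for j
    using F[OF that] ii' by (auto simp: D_def intro: power_decreasing)
  have D0: "D 0 = 0" using ii' by (simp add: D_def F0 zero_power)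
  \<comment> \<open>Summation by parts as an induction; at \<open>m = N\<close> the left side is
    \<open>0\<close>. At \<open>m = 0\<close> the point \<open>0\<close> lies outside the domain
    where \<open>g\<close> is monotone, but \<open>D 0 = 0\<close> removes it.\<close>
  have "D m * g m \<le> (\<Sum>j=1..m. (D j - D (j - 1)) * g j)" if "m \<le> N" for m
    using that
  proof (induction m)
    case (Suc m)
    have "D m * g (Suc m) \<le> D m * g m"
      using D0 D_nonneg[of m] monotone_onD[OF g, of m "Suc m"] Suc.prems
      by (cases "m = 0") (auto intro: mult_left_mono)
    with Suc show ?case by (simp add: algebra_simps)
  qed (simp add: D0)
  from this[of N] have "0 \<le> (\<Sum>j=1..N. (D j - D (j - 1)) * g j)" by (simp add: D_def FN)
  also have "\<dots> = (\<Sum>j=1..N. lamperti_matrix F i j * g j) - (\<Sum>j=1..N. lamperti_matrix F i' j * g j)"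
    by (simp add: D_def lamperti_matrix_def algebra_simps sum_subtractf sum.distrib)
  finally show ?thesis by simp
qed

text \<open>Extending \<open>survival\<close> by \<open>0\<close> at the absorbing state keeps it
  decreasing, since it is nonnegative, and each further step applies a matrix that preserves
  decreasing functions.\<close>

lemma lamperti_survival_antimono:
  assumes F0: "F 0 = 0" and FN: "F N = 1" and F: "mono_on {..N} F"
  shows "antimono_on {1..N} (\<lambda>i. if i < N then survival {1..<N} (lamperti_matrix F) n i else 0)"
proof (induction n)
  case 0
  then show ?case by (auto simp: monotone_on_def)
next
  case (Suc n)
  have F01: "F j \<in> {0..1}" if "j \<le> N" for j
    using that mono_onD[OF F, of 0 j] mono_onD[OF F, of j N] by (simp add: F0 FN)
  have nonneg: "lamperti_matrix F i j \<ge> 0" if "j \<le> N" for i j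
    using that F01[of "j - 1"] mono_onD[OF F, of "j - 1" j]
    by (auto simp: lamperti_matrix_def intro: power_mono)
  have surv: "survival {1..<N} (lamperti_matrix F) k i \<ge> 0" for k i
    by (induction k arbitrary: i) (auto intro!: sum_nonneg mult_nonneg_nonneg nonneg)
  \<comment> \<open>The value \<open>0\<close> at \<open>N\<close> completes the truncated sum to a
    full row, which is what stochastic comparison requires.\<close>
  have eq: "survival {1..<N} (lamperti_matrix F) (Suc n) i
      = (\<Sum>j=1..N. lamperti_matrix F i j * (if j < N then survival {1..<N} (lamperti_matrix F) n j else 0))" for i
    unfolding survival.simps by (rule sum.mono_neutral_cong_left) auto
  show ?case
    unfolding monotone_on_def
  proof (intro ballI impI)
    fix i i' assume ii': "i \<in> {1..N}" "i' \<in> {1..N}" "i \<le> i'"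
    then have "survival {1..<N} (lamperti_matrix F) (Suc n) i'
        \<le> survival {1..<N} (lamperti_matrix F) (Suc n) i"
      unfolding eq by (intro lamperti_matrix_antimono F0 FN F01 Suc.IH) auto
    then show "(if i < N then survival {1..<N} (lamperti_matrix F) (Suc n) i else 0)
        \<ge> (if i' < N then survival {1..<N} (lamperti_matrix F) (Suc n) i' else 0)"
      using ii' surv[of "Suc n" i] by (simp del: survival.simps)
  qed
qed

section \<open>The truncated Lamperti chain\<close>

text \<open>Since \<nu> charges every \<open>j \<ge> 1\<close>, all matrix entries are positive, and
  any state charged by \<pi> sends mass to every state in one step.\<close>

lemma lamperti_invariant_pos:
  assumes \<nu>: "set_pmf \<nu> = {1..}"
    and inv: "invariant_pmf {1..} (lamperti_matrix (distr_fun \<nu>)) \<pi>" and j: "j \<ge> 1"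
  shows "pmf \<pi> j > 0"
proof -
  let ?P = "lamperti_matrix (distr_fun \<nu>)"
  have step: "distr_fun \<nu> j = distr_fun \<nu> (j - 1) + pmf \<nu> j" if "j \<ge> 1" for j
  proof -
    have "{..j} = insert j {..j - 1}" using that by auto
    then show ?thesis using that
      by (simp add: distr_fun_def measure_measure_pmf_finite)
  qed
  have pos: "?P i j > 0" if "i \<ge> 1" "j \<ge> 1" for i j
  proof -
    have "pmf \<nu> j > 0" using \<nu> that by (simp add: pmf_positive_iff)
    then have "distr_fun \<nu> (j - 1) < distr_fun \<nu> j" using step[OF that(2)] by simp
    then show ?thesis
      using that by (auto simp: lamperti_matrix_def distr_fun_def intro!: power_strict_mono)
  qed
  obtain i where i: "i \<in> set_pmf \<pi>" using set_pmf_not_empty by fast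
  have S: "set_pmf \<pi> \<subseteq> {1..}"
    and sums: "((\<lambda>i. pmf \<pi> i * ?P i j) has_sum pmf \<pi> j) {1..}"
    using inv j by (auto simp: invariant_pmf_def)
  have i1: "i \<ge> 1" using i S by auto
  have "pmf \<pi> i * ?P i j \<le> pmf \<pi> j"
  proof (rule has_sum_mono2[OF has_sum_finite sums, of "{i}", simplified])
    show "0 \<le> pmf \<pi> k * ?P k j" if "Suc 0 \<le> k \<and> k \<noteq> i" for k
      using that pos[of k j] j by simp
  qed (use i1 in auto)
  moreover have "pmf \<pi> i * ?P i j > 0"
    using i pos[OF i1 j] by (simp add: pmf_positive_iff)
  ultimately show ?thesis by linarith
qed

section \<open>The truncated invariant law and its distribution function\<close>

lemma truncated_pi_pos:
  assumes "\<And>k. k \<ge> 1 \<Longrightarrow> pmf \<pi> k > 0" "k \<in> {1..N}"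
  shows "truncated_pi \<pi> N k > 0"
proof -
  have "(\<Sum>l=1..N. pmf \<pi> l) > 0" using assms by (intro sum_pos) auto
  then show ?thesis using assms by (simp add: truncated_pi_def)
qed

lemma sum_truncated_pi:
  assumes "\<And>k. k \<ge> 1 \<Longrightarrow> pmf \<pi> k > 0" "N \<ge> 1"
  shows "(\<Sum>k=1..N. truncated_pi \<pi> N k) = 1"
proof -
  have "(\<Sum>l=1..N. pmf \<pi> l) > 0" using assms by (intro sum_pos) auto
  then show ?thesis by (simp add: truncated_pi_def flip: sum_divide_distrib)
qed

lemma power_sum_strict_mono:
  fixes p :: "nat \<Rightarrow> real"
  assumes "\<And>k. k \<in> {1..N} \<Longrightarrow> p k > 0" "N \<ge> 1" "0 \<le> x" "x < y"
  shows "(\<Sum>k=1..N. p k * x ^ k) < (\<Sum>k=1..N. p k * y ^ k)"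
  using assms by (intro sum_strict_mono mult_strict_left_mono power_strict_mono) auto

text \<open>Makes the definite description usable: the generating function of the truncated law runs
  continuously from \<open>0\<close> to \<open>1\<close>, which gives existence, and strictly
  increases, which gives uniqueness.\<close>

lemma truncated_F:
  assumes \<pi>: "\<And>k. k \<ge> 1 \<Longrightarrow> pmf \<pi> k > 0" and j: "j \<le> N" and N: "N \<ge> 1"
  shows "truncated_F \<pi> N j \<in> {0..1}"
    and "(\<Sum>k=1..N. truncated_pi \<pi> N k * truncated_F \<pi> N j ^ k) = (\<Sum>k=1..j. truncated_pi \<pi> N k)"
proof -
  let ?p = "truncated_pi \<pi> N"
  let ?G = "\<lambda>x. \<Sum>k=1..N. ?p k * x ^ k"
  have p: "?p k > 0" if "k \<in> {1..N}" for k using truncated_pi_pos[OF \<pi> that] by blast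
  have p1: "(\<Sum>k=1..N. ?p k) = 1" using sum_truncated_pi[OF \<pi> N] by simp
  have G0: "?G 0 = 0" by (intro sum.neutral) auto
  have G_less: "?G x < ?G y" if "0 \<le> x" "x < y" for x y
    using p N that by (rule power_sum_strict_mono)
  have "truncated_F \<pi> N j \<in> {0..1} \<and> ?G (truncated_F \<pi> N j) = (\<Sum>k=1..j. ?p k)"
  proof (cases "j = 0")
    case True
    \<comment> \<open>The default value \<open>0\<close> solves the equation too: the sum on the
      right is empty and the generating function has no constant term.\<close>
    then show ?thesis using G0 by (simp add: truncated_F_def)
  next
    case False
    have "0 \<le> (\<Sum>k=1..j. ?p k)" using p j by (intro sum_nonneg) (auto intro: less_imp_le)
    moreover have "(\<Sum>k=1..j. ?p k) \<le> (\<Sum>k=1..N. ?p k)"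
      using p j by (intro sum_mono2) (auto intro: less_imp_le)
    moreover have "continuous_on {0..1} ?G" by (intro continuous_intros)
    ultimately obtain x where x: "x \<in> {0..1}" "?G x = (\<Sum>k=1..j. ?p k)"
      using IVT'[of ?G 0 "\<Sum>k=1..j. ?p k" 1] G0 p1 by auto
    have "\<exists>!x. x \<in> {0..1} \<and> (\<Sum>k=1..j. ?p k) = ?G x"
    proof (rule ex1I)
      show "x \<in> {0..1} \<and> (\<Sum>k=1..j. ?p k) = ?G x" using x by simp
      fix y assume y: "y \<in> {0..1} \<and> (\<Sum>k=1..j. ?p k) = ?G y"
      then have "?G x = ?G y" using x by simp
      then show "y = x"
        using G_less[of x y] G_less[of y x] x y
        by (cases x y rule: linorder_cases) auto
    qed
    from theI'[OF this] False show ?thesis by (simp add: truncated_F_def)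
  qed
  then show "truncated_F \<pi> N j \<in> {0..1}" "?G (truncated_F \<pi> N j) = (\<Sum>k=1..j. ?p k)" by auto
qed

text \<open>The generating function reaches the total mass \<open>1\<close> only at the argument
  \<open>1\<close>.\<close>

lemma truncated_F_top:
  assumes \<pi>: "\<And>k. k \<ge> 1 \<Longrightarrow> pmf \<pi> k > 0" and N: "N \<ge> 1"
  shows "truncated_F \<pi> N N = 1"
proof (rule ccontr)
  assume "truncated_F \<pi> N N \<noteq> 1"
  then have "truncated_F \<pi> N N \<ge> 0" "truncated_F \<pi> N N < 1"
    using truncated_F(1)[OF \<pi> order_refl N] by auto
  moreover have "truncated_pi \<pi> N k > 0" if "k \<in> {1..N}" for k
    using truncated_pi_pos[OF \<pi> that] by blast
  ultimately have "(\<Sum>k=1..N. truncated_pi \<pi> N k * truncated_F \<pi> N N ^ k)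
      < (\<Sum>k=1..N. truncated_pi \<pi> N k * 1 ^ k)"
    by (intro power_sum_strict_mono N)
  then show False using truncated_F(2)[OF \<pi> order_refl N] by simp
qed

text \<open>The partial sums increase strictly because all weights are positive, and an increasing
  generating function reflects strict order.\<close>

lemma truncated_F_strict_mono:
  assumes \<pi>: "\<And>k. k \<ge> 1 \<Longrightarrow> pmf \<pi> k > 0" and N: "N \<ge> 1"
  shows "strict_mono_on {..N} (truncated_F \<pi> N)"
proof (rule strict_mono_onI, rule ccontr)
  let ?p = "truncated_pi \<pi> N" and ?F = "truncated_F \<pi> N"
  fix j j' assume jj': "j \<in> {..N}" "j' \<in> {..N}" "j < j'" "\<not> ?F j < ?F j'"
  have p: "?p k > 0" if "k \<in> {1..N}" for k using truncated_pi_pos[OF \<pi> that] by blast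
  have "(\<Sum>k=1..j. ?p k) < (\<Sum>k=1..j'. ?p k)"
    by (rule sum_strict_mono2[of _ _ j']) (use jj' p in \<open>auto intro: order.strict_implies_order\<close>)
  moreover have "(\<Sum>k=1..N. ?p k * ?F j' ^ k) \<le> (\<Sum>k=1..N. ?p k * ?F j ^ k)"
    using jj' p truncated_F(1)[OF \<pi> _ N, of j']
    by (intro sum_mono mult_left_mono power_mono) (auto intro: less_imp_le)
  ultimately show False using truncated_F(2)[OF \<pi> _ N] jj' by simp
qed

lemma truncated_P_pos:
  assumes \<pi>: "\<And>k. k \<ge> 1 \<Longrightarrow> pmf \<pi> k > 0" and ij: "i \<in> {1..N}" "j \<in> {1..N}"
  shows "truncated_P \<pi> N i j > 0"
proof -
  have "truncated_F \<pi> N (j - 1) < truncated_F \<pi> N j"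
    using strict_mono_onD[OF truncated_F_strict_mono[OF \<pi>, of N], of "j - 1" j] ij by auto
  moreover have "truncated_F \<pi> N (j - 1) \<ge> 0"
    using truncated_F(1)[OF \<pi>, of "j - 1" N] ij by auto
  ultimately show ?thesis
    using ij by (auto simp: lamperti_matrix_def intro!: power_strict_mono)
qed

text \<open>Chebyshev's inequality with the truncated law as weights, applied to the density of
  \<open>\<pi>\<^sub>0\<close> and to the survival function. The density has mean \<open>1\<close>,
  so that factor disappears.\<close>

lemma survival_sum_dominates:
  assumes \<pi>: "\<And>k. k \<ge> 1 \<Longrightarrow> pmf \<pi> k > 0" and N: "N \<ge> 1"
    and \<pi>\<^sub>0: "set_pmf \<pi>\<^sub>0 \<subseteq> {1..N}"
    and anti: "antimono_on {1..N} (\<lambda>i. pmf \<pi>\<^sub>0 i / truncated_pi \<pi> N i)"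
  shows "(\<Sum>i\<in>{1..<N}. truncated_pi \<pi> N i * survival {1..<N} (truncated_P \<pi> N) n i)
       \<le> (\<Sum>i\<in>{1..<N}. pmf \<pi>\<^sub>0 i * survival {1..<N} (truncated_P \<pi> N) n i)"
proof -
  let ?p = "truncated_pi \<pi> N"
  define g where "g i = (if i < N then survival {1..<N} (truncated_P \<pi> N) n i else 0)" for i
  have p: "?p k > 0" if "k \<in> {1..N}" for k using truncated_pi_pos[OF \<pi> that] by blast
  \<comment> \<open>Extension by \<open>0\<close> at \<open>N\<close> lets the weights run over
    \<open>{1..N}\<close>, where their total mass is \<open>1\<close>.\<close>
  have g_sum: "(\<Sum>i\<in>{1..<N}. q i * survival {1..<N} (truncated_P \<pi> N) n i) = (\<Sum>i=1..N. q i * g i)"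
    for q :: "nat \<Rightarrow> real"
    by (rule sum.mono_neutral_cong_left) (auto simp: g_def)
  have "antimono_on {1..N} g"
    unfolding g_def
    using truncated_F_top[OF \<pi> N] strict_mono_on_imp_mono_on[OF truncated_F_strict_mono[OF \<pi> N]]
    by (intro lamperti_survival_antimono) (auto simp: truncated_F_def)
  then have "(\<Sum>i=1..N. ?p i * (pmf \<pi>\<^sub>0 i / ?p i)) * (\<Sum>i=1..N. ?p i * g i)
      \<le> (\<Sum>i=1..N. ?p i * (pmf \<pi>\<^sub>0 i / ?p i) * g i)"
    using p sum_truncated_pi[OF \<pi> N] anti by (intro weighted_chebyshev_sum) (auto intro: less_imp_le)
  moreover have "?p i * (pmf \<pi>\<^sub>0 i / ?p i) = pmf \<pi>\<^sub>0 i" if "i \<in> {1..N}" for i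
    using p[OF that] by simp
  moreover have "(\<Sum>i=1..N. pmf \<pi>\<^sub>0 i) = 1" using \<pi>\<^sub>0 by (simp add: sum_pmf_eq_1)
  ultimately show ?thesis unfolding g_sum by simp
qed

section \<open>Assembly of the limit and the bound\<close>

lemma scalar_prod_restrict_vec:
  assumes "dim_vec \<phi> = N - 1"
  shows "restrict_vec N v \<bullet> \<phi> = (\<Sum>i\<in>{1..<N}. v i * \<phi> $ (i - 1))"
  unfolding scalar_prod_def assms restrict_vec_def
  by (rule sum.reindex_bij_witness[of _ "\<lambda>i. i - 1" "\<lambda>i. i + 1"]) auto

theorem proposition15:
  fixes N :: nat and \<nu> \<pi> \<pi>\<^sub>0 :: "nat pmf"
    and M :: "'a measure" and X :: "nat \<Rightarrow> 'a \<Rightarrow> nat"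
    and M' :: "'b measure" and Y :: "nat \<Rightarrow> 'b \<Rightarrow> nat"
    and \<rho> :: real and \<mu> \<phi> :: "real vec"
  assumes "N \<ge> 2"
    and "set_pmf \<nu> = {1..}"
    and "positive_recurrent {1..} (lamperti_matrix (distr_fun \<nu>))"
    and "invariant_pmf {1..} (lamperti_matrix (distr_fun \<nu>)) \<pi>"
    and "set_pmf \<pi>\<^sub>0 \<subseteq> {1..N}"
    and "antimono_on {1..N} (\<lambda>i. pmf \<pi>\<^sub>0 i / truncated_pi \<pi> N i)"
    and "pmf \<pi>\<^sub>0 N = 0"
    and "markov_chain M {1..N} (truncated_P \<pi> N) (pmf \<pi>\<^sub>0) X"
    and "markov_chain M' {1..N} (truncated_P \<pi> N) (truncated_pi \<pi> N) Y"
    and "dominant_eigenvalue (restrict_mat N (truncated_P \<pi> N)) \<rho>"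
    and "eigenvector (restrict_mat N (truncated_P \<pi> N))\<^sup>T \<mu> \<rho>"
    and "eigenvector (restrict_mat N (truncated_P \<pi> N)) \<phi> \<rho>"
    and "positive_vec \<mu>" and "positive_vec \<phi>"
    and "(\<Sum>i<N - 1. \<mu> $ i) = 1"
    and "\<mu> \<bullet> \<phi> = 1"
  shows "(\<lambda>n. \<P>(\<omega> in M. hitting_time X N \<omega> > enat n) / \<P>(\<omega> in M'. hitting_time Y N \<omega> > enat n))
           \<longlonglongrightarrow> (restrict_vec N (pmf \<pi>\<^sub>0) \<bullet> \<phi>) / (restrict_vec N (truncated_pi \<pi> N) \<bullet> \<phi>)
       \<and> (restrict_vec N (pmf \<pi>\<^sub>0) \<bullet> \<phi>) / (restrict_vec N (truncated_pi \<pi> N) \<bullet> \<phi>) \<ge> 1"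
proof -
  let ?T = "{1..<N}" and ?P = "truncated_P \<pi> N" and ?p = "truncated_pi \<pi> N"
  let ?s = "survival ?T ?P" and ?\<phi> = "\<lambda>i. \<phi> $ (i - 1)"
  have \<pi>: "pmf \<pi> k > 0" if "k \<ge> 1" for k
    using lamperti_invariant_pos[OF assms(2,4) that] .
  have T: "finite ?T" "?T \<noteq> {}" using \<open>N \<ge> 2\<close> by auto
  have T_eq: "{1..N} - {N} = ?T" by auto
  have p: "?p i > 0" if "i \<in> ?T" for i using truncated_pi_pos[OF \<pi>] that by auto
  have P: "?P i j > 0" if "i \<in> ?T" "j \<in> ?T" for i j using truncated_P_pos[OF \<pi>] that by auto
  have dim: "dim_vec \<phi> = N - 1"
    and eigv: "restrict_mat N ?P *\<^sub>v \<phi> = \<rho> \<cdot>\<^sub>v \<phi>"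
    using assms(12) by (auto simp: eigenvector_def restrict_mat_def)
  have \<phi>_pos: "?\<phi> i > 0" if "i \<in> ?T" for i
    using assms(14) that by (auto simp: positive_vec_def dim)
  \<comment> \<open>The eigenvector equation at entry \<open>i - 1\<close>, rewritten as a sum over
    states numbered from \<open>1\<close>.\<close>
  have eig: "(\<Sum>j\<in>?T. ?P i j * ?\<phi> j) = \<rho> * ?\<phi> i" if i: "i \<in> ?T" for i
  proof -
    have "row (restrict_mat N ?P) (i - 1) = restrict_vec N (?P i)"
      using i by (auto simp: restrict_mat_def restrict_vec_def)
    then have "restrict_vec N (?P i) \<bullet> \<phi> = (restrict_mat N ?P *\<^sub>v \<phi>) $ (i - 1)"
      using i by (subst index_mult_mat_vec) (auto simp: restrict_mat_def)
    also have "\<dots> = \<rho> * ?\<phi> i" using i by (subst eigv, subst index_smult_vec) (auto simp: dim)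
    finally show ?thesis by (simp add: scalar_prod_restrict_vec[OF dim])
  qed
  have \<rho>: "\<rho> > 0" by (rule survival_asymptotics(1)[OF T P \<phi>_pos eig])
  have "\<exists>c>0. \<forall>i\<in>?T. (\<lambda>n. ?s n i / \<rho> ^ n) \<longlonglongrightarrow> c * ?\<phi> i"
    by (rule survival_asymptotics(2)[OF T P \<phi>_pos eig])
  then obtain c where c: "c > 0" "\<And>i. i \<in> ?T \<Longrightarrow> (\<lambda>n. ?s n i / \<rho> ^ n) \<longlonglongrightarrow> c * ?\<phi> i"
    by blast
  \<comment> \<open>The constant \<open>c\<close> is the same for every initial weight \<sigma>, so
    it cancels in the quotient together with \<open>\<rho> ^ n\<close>.\<close>
  have lim: "(\<lambda>n. (\<Sum>i\<in>?T. \<sigma> i * ?s n i) / \<rho> ^ n) \<longlonglongrightarrow> c * (restrict_vec N \<sigma> \<bullet> \<phi>)" for \<sigma>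
  proof -
    have "(\<lambda>n. \<Sum>i\<in>?T. \<sigma> i * (?s n i / \<rho> ^ n)) \<longlonglongrightarrow> (\<Sum>i\<in>?T. \<sigma> i * (c * ?\<phi> i))"
      by (intro tendsto_sum tendsto_mult_left c)
    then show ?thesis
      by (simp add: scalar_prod_restrict_vec[OF dim] sum_divide_distrib sum_distrib_left mult_ac)
  qed
  have p\<phi>: "restrict_vec N ?p \<bullet> \<phi> > 0"
    unfolding scalar_prod_restrict_vec[OF dim] using T p \<phi>_pos by (intro sum_pos) auto
  have ratio: "\<P>(\<omega> in M. hitting_time X N \<omega> > enat n) / \<P>(\<omega> in M'. hitting_time Y N \<omega> > enat n)
      = (\<Sum>i\<in>?T. pmf \<pi>\<^sub>0 i * ?s n i) / (\<Sum>i\<in>?T. ?p i * ?s n i)" for n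
    using markov_chain_hitting_time_gt[OF assms(8), of n N]
      markov_chain_hitting_time_gt[OF assms(9), of n N] by (simp add: T_eq del: One_nat_def)
  have conv: "(\<lambda>n. (\<Sum>i\<in>?T. pmf \<pi>\<^sub>0 i * ?s n i) / (\<Sum>i\<in>?T. ?p i * ?s n i))
      \<longlonglongrightarrow> (restrict_vec N (pmf \<pi>\<^sub>0) \<bullet> \<phi>) / (restrict_vec N ?p \<bullet> \<phi>)"
    using tendsto_divide[OF lim[of "pmf \<pi>\<^sub>0"] lim[of ?p]] c(1) p\<phi> \<rho> by simp
  \<comment> \<open>The bound holds at every finite \<open>n\<close> and passes to the
    limit.\<close>
  have "1 \<le> (\<Sum>i\<in>?T. pmf \<pi>\<^sub>0 i * ?s n i) / (\<Sum>i\<in>?T. ?p i * ?s n i)" for n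
  proof -
    have "(\<Sum>i\<in>?T. ?p i * ?s n i) > 0"
      using T p survival_pos[OF T P] by (intro sum_pos mult_pos_pos) auto
    then show ?thesis
      using survival_sum_dominates[OF \<pi> _ assms(5,6), of n] \<open>N \<ge> 2\<close> by simp
  qed
  with conv show ?thesis
    unfolding ratio by (auto intro!: LIMSEQ_le_const[OF conv])
qed

end
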